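(* Consider the two-player Markov game, the risk-sensitive quantal level-$k$ construction, and the CPT weights described in the context. Let $i\in\{1,2\}$ be an arbitrary agent, and suppose that the one-step rewards are bounded below by a constant $R_{\min}$ with $R_{\min}\ge 1$, i.e. $R^i(s,a^i,a^{-i})\ge R_{\min}\ge 1$ for all $(s,a^i,a^{-i})$. Then for every intelligence level $k=1,2,\dots$ the dynamic programming problem $$V^{*,i,k}(s)=\max_{a^i\in A^i}\mathbb{CPT}_{\pi^{*,-i,k-1}}\big[R^i(s,a^i,a^{-i})+\tilde\gamma V^{*,i,k}(\mathcal T(s,a^i,a^{-i}))\big],\qquad s\in\mathcal S,$$ is solved by the value iteration $$V^{i,k}_{m+1}(s)=\max_{a^i\in A^i}\sum_{a^{-i}\in A^{-i}}\rho^i(c^{a^{-i}}_{s,a^i})\,u^i\big(R^i(s,a^i,a^{-i})+\tilde\gamma V^{i,k}_m(s')\big),\qquad s'=\mathcal T(s,a^i,a^{-i}),\ s\in\mathcal S,\ m\ge 0,$$ started from an arbitrary initial function $V^{i,k}_0:\mathcal S\to\mathbb R$. That is, for all $s\in\mathcal S$, $V^{i,k}_{m+1}(s)$ converges to the optimal value $V^{*,i,k}(s)$ as $m\to\infty$.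
   Context: **Game.** There are two agents $\mathcal P=\{1,2\}$; for $i\in\mathcal P$, $-i$ denotes the other agent. The joint state space $\mathcal S$ and the action sets $A^1,A^2$ are finite and nonempty. The transition $\mathcal T$ is deterministic: $\mathcal T(s,a^i,a^{-i})\in\mathcal S$. Agent $i$ has one-step reward $R^i:\mathcal S\times A^i\times A^{-i}\to\mathbb R$; rewards are positive. The discount factor is $\tilde\gamma\in(0,1)$. **Utility and probability weighting.** Each agent has a utility $u^i=u^+$ with $u^+(x)=x^\alpha$ for $x\ge 0$ and $u^+(x)=0$ for $x<0$, where $\alpha\in(0,1]$. Each agent has a probability weighting function $w^+:[0,1]\to[0,1]$, continuous and non-decreasing, of the form $w^+(p)=\dfrac{p^\gamma}{(p^\gamma+(1-p)^\gamma)^{1/\gamma}}$ with $\gamma\in(0,1]$. The parameters may depend on the agent. **CPT value (gains only, reference point $0$).** Let $X$ be a random variable with finitely many outcomes listed in non-decreasing order $x_0\le x_1\le\dots\le x_n$, with probabilities $p_0,\dots,p_n$ summing to $1$. Then $$\mathbb{CPT}(X)=\sum_{j=0}^n\tilde\rho^+_j\,u^+(x_j),\qquad \tilde\rho^+_j=w^+\Big(\sum_{l=j}^n p_l\Big)-w^+\Big(\sum_{l=j+1}^n p_l\Big).$$ **Weights.** Fix agent $i$, level $k\ge 1$, state $s$ and action $a^i$. The opponent's action $a^{-i}$ is random with law $\mathbb P(a^{-i}\mid s,a^i)$ given by the level-$(k-1)$ policy of agent $-i$ (defined below). Write $c^{a^{-i}}_{s,a^i}:=\langle s,a^i,a^{-i}\rangle$.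 Let $\tilde\rho^i(c^{a^{-i}}_{s,a^i})$ be the CPT weight $\tilde\rho^+$ (with agent $i$'s $w^+$) attached to the outcome indexed by $a^{-i}$, where the outcomes are the values $R^i(s,a^i,a^{-i})+\tilde\gamma V(\mathcal T(s,a^i,a^{-i}))$, $a^{-i}\in A^{-i}$, for the value function $V$ being inserted ($V=V^{i,k}_m$ in the iteration), listed in non-decreasing order. The normalized weight is $$\rho^i(c^{a^{-i}}_{s,a^i})=\frac{\tilde\rho^i(c^{a^{-i}}_{s,a^i})}{\sum_{b\in A^{-i}}\tilde\rho^i(c^{b}_{s,a^i})}.$$ **Quantal level-$k$ policies.** An anchoring level-$0$ stochastic policy $\pi^{*,j,0}$ is given for each agent $j$. It is a probability distribution over $A^j$ for each state, and is allowed to depend also on the other agent's current action. For $k\ge1$, agent $i$ assumes that agent $-i$ plays $\pi^{*,-i,k-1}$. The optimal CPT value function $V^{*,i,k}:\mathcal S\to\mathbb R$ of agent $i$ (the optimal discounted nested CPT value against $\pi^{*,-i,k-1}$) is the solution of the dynamic programming equation displayed in the claim, where $\mathbb{CPT}_{\pi^{*,-i,k-1}}$ is the CPT value with respect to the randomness of $a^{-i}\sim\pi^{*,-i,k-1}$. Set $Q^{*,i,k}(s,a^i)=\mathbb{CPT}_{\pi^{*,-i,k-1}}[R^i(s,a^i,a^{-i})+\tilde\gamma V^{*,i,k}(\mathcal T(s,a^i,a^{-i}))]$. The level-$k$ policy is $$\pi^{*,i,k}(s,a^i)=\frac{\exp(Q^{*,i,k}(s,a^i))}{\sum_{a'\in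 A^i}\exp(Q^{*,i,k}(s,a'))}.$$ The levels are defined recursively in $k$ for both agents; the reward lower bound in the claim is assumed for both agents, since agent $i$ is arbitrary. *)

theory Defs
  imports Complex_Main
begin

datatype agent = Agent1 | Agent2

primrec opp :: "agent \<Rightarrow> agent" where
  "opp Agent1 = Agent2"
| "opp Agent2 = Agent1"

definition utility :: "real \<Rightarrow> real \<Rightarrow> real" where
  "utility \<alpha> x = (if 0 \<le> x then x powr \<alpha> else 0)"

definition weighting :: "real \<Rightarrow> real \<Rightarrow> real" where
  "weighting \<gamma> p = p powr \<gamma> / (p powr \<gamma> + (1 - p) powr \<gamma>) powr (1 / \<gamma>)"

text \<open>
  Monotonicity is a genuine restriction on the parameter: the formula above is not monotone on
  the unit interval for small \<open>\<gamma>\<close>.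
\<close>

definition weighting_function :: "(real \<Rightarrow> real) \<Rightarrow> bool" where
  "weighting_function w \<longleftrightarrow>
     w ` {0..1} \<subseteq> {0..1} \<and> continuous_on {0..1} w \<and> mono_on {0..1} w"

text \<open>
  A random variable with finitely many outcomes is given by a finite index set \<open>B\<close>, the
  probabilities \<open>p b\<close> and the outcomes \<open>f b\<close> for \<open>b \<in> B\<close>. A listing enumerates \<open>B\<close> so that
  the outcomes are non-decreasing. Ties are broken arbitrarily: the tie-breaking
  affects individual weights, but not the CPT value.
\<close>

definition listing :: "'b set \<Rightarrow> ('b \<Rightarrow> real) \<Rightarrow> 'b list" where
  "listing B f = (SOME xs. distinct xs \<and> set xs = B \<and> sorted (map f xs))"

definition rank_weight :: "(real \<Rightarrow> real) \<Rightarrow> ('b \<Rightarrow> real) \<Rightarrow> 'b list \<Rightarrow> nat \<Rightarrow> real" where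
  "rank_weight w p xs j =
     w (\<Sum>l = j..<length xs. p (xs ! l)) - w (\<Sum>l = Suc j..<length xs. p (xs ! l))"

definition CPT ::
  "(real \<Rightarrow> real) \<Rightarrow> (real \<Rightarrow> real) \<Rightarrow> 'b set \<Rightarrow> ('b \<Rightarrow> real) \<Rightarrow> ('b \<Rightarrow> real) \<Rightarrow> real" where
  "CPT w u B p f =
     (let xs = listing B f in \<Sum>j<length xs. rank_weight w p xs j * u (f (xs ! j)))"

definition cpt_weight ::
  "(real \<Rightarrow> real) \<Rightarrow> 'b set \<Rightarrow> ('b \<Rightarrow> real) \<Rightarrow> ('b \<Rightarrow> real) \<Rightarrow> 'b \<Rightarrow> real" where
  "cpt_weight w B p f b =
     (let xs = listing B f in rank_weight w p xs (THE j. j < length xs \<and> xs ! j = b))"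

definition normalized_weight ::
  "(real \<Rightarrow> real) \<Rightarrow> 'b set \<Rightarrow> ('b \<Rightarrow> real) \<Rightarrow> ('b \<Rightarrow> real) \<Rightarrow> 'b \<Rightarrow> real" where
  "normalized_weight w B p f b = cpt_weight w B p f b / (\<Sum>b'\<in>B. cpt_weight w B p f b')"

text \<open>
  Conventions: \<open>trans G s a1 a2\<close> takes the actions of \<open>Agent1\<close> and \<open>Agent2\<close> in this order,
  whereas \<open>reward G i s a b\<close> takes agent \<open>i\<close>'s own action \<open>a\<close> first.
  For a policy \<open>\<pi>\<close> of agent \<open>j\<close>, \<open>\<pi> s b a\<close> is the probability that \<open>j\<close> plays \<open>a\<close>
  in state \<open>s\<close> when the other agent's current action is \<open>b\<close>.
\<close>

type_synonym ('s, 'a) policy = "'s \<Rightarrow> 'a \<Rightarrow> 'a \<Rightarrow> real"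

record ('s, 'a) game =
  acts :: "agent \<Rightarrow> 'a set"
  trans :: "'s \<Rightarrow> 'a \<Rightarrow> 'a \<Rightarrow> 's"
  reward :: "agent \<Rightarrow> 's \<Rightarrow> 'a \<Rightarrow> 'a \<Rightarrow> real"
  discount :: real
  util_param :: "agent \<Rightarrow> real"
  weight_param :: "agent \<Rightarrow> real"
  anchor :: "agent \<Rightarrow> ('s, 'a) policy"

definition valid_game :: "('s::finite, 'a) game \<Rightarrow> bool" where
  "valid_game G \<longleftrightarrow>
     (\<forall>i. finite (acts G i) \<and> acts G i \<noteq> {}) \<and>
     (\<forall>i s. \<forall>a\<in>acts G i. \<forall>b\<in>acts G (opp i). 0 < reward G i s a b) \<and>
     0 < discount G \<and> discount G < 1 \<and>
     (\<forall>i. 0 < util_param G i \<and> util_param G i \<le> 1) \<and>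
     (\<forall>i. 0 < weight_param G i \<and> weight_param G i \<le> 1 \<and>
          weighting_function (weighting (weight_param G i))) \<and>
     (\<forall>j s. \<forall>b\<in>acts G (opp j).
          (\<forall>a\<in>acts G j. 0 \<le> anchor G j s b a) \<and> (\<Sum>a\<in>acts G j. anchor G j s b a) = 1)"

definition next_state :: "('s, 'a) game \<Rightarrow> agent \<Rightarrow> 's \<Rightarrow> 'a \<Rightarrow> 'a \<Rightarrow> 's" where
  "next_state G i s a b = (case i of Agent1 \<Rightarrow> trans G s a b | Agent2 \<Rightarrow> trans G s b a)"

definition outcome ::
  "('s, 'a) game \<Rightarrow> agent \<Rightarrow> ('s \<Rightarrow> real) \<Rightarrow> 's \<Rightarrow> 'a \<Rightarrow> 'a \<Rightarrow> real" where
  "outcome G i V s a b = reward G i s a b + discount G * V (next_state G i s a b)"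

text \<open>In the following, \<open>\<pi>\<close> is the policy of the opponent of agent \<open>i\<close>.\<close>

definition Q_value ::
  "('s, 'a) game \<Rightarrow> agent \<Rightarrow> ('s, 'a) policy \<Rightarrow> ('s \<Rightarrow> real) \<Rightarrow> 's \<Rightarrow> 'a \<Rightarrow> real" where
  "Q_value G i \<pi> V s a =
     CPT (weighting (weight_param G i)) (utility (util_param G i))
       (acts G (opp i)) (\<pi> s a) (outcome G i V s a)"

definition solves_dp ::
  "('s, 'a) game \<Rightarrow> agent \<Rightarrow> ('s, 'a) policy \<Rightarrow> ('s \<Rightarrow> real) \<Rightarrow> bool" where
  "solves_dp G i \<pi> V \<longleftrightarrow> (\<forall>s. V s = (MAX a\<in>acts G i. Q_value G i \<pi> V s a))"

definition optimal_value ::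
  "('s, 'a) game \<Rightarrow> agent \<Rightarrow> ('s, 'a) policy \<Rightarrow> 's \<Rightarrow> real" where
  "optimal_value G i \<pi> = (THE V. solves_dp G i \<pi> V)"

text \<open>The quantal response ignores the other agent's current action \<open>b\<close>.\<close>

definition quantal_response ::
  "('s, 'a) game \<Rightarrow> agent \<Rightarrow> ('s, 'a) policy \<Rightarrow> ('s, 'a) policy" where
  "quantal_response G i \<pi> s b a =
     exp (Q_value G i \<pi> (optimal_value G i \<pi>) s a) /
     (\<Sum>a'\<in>acts G i. exp (Q_value G i \<pi> (optimal_value G i \<pi>) s a'))"

primrec level_policy :: "('s, 'a) game \<Rightarrow> nat \<Rightarrow> agent \<Rightarrow> ('s, 'a) policy" where
  "level_policy G 0 = anchor G"
| "level_policy G (Suc k) = (\<lambda>i. quantal_response G i (level_policy G k (opp i)))"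

definition V_star :: "('s, 'a) game \<Rightarrow> agent \<Rightarrow> nat \<Rightarrow> 's \<Rightarrow> real" where
  "V_star G i k = optimal_value G i (level_policy G (k - 1) (opp i))"

definition value_step ::
  "('s, 'a) game \<Rightarrow> agent \<Rightarrow> ('s, 'a) policy \<Rightarrow> ('s \<Rightarrow> real) \<Rightarrow> 's \<Rightarrow> real" where
  "value_step G i \<pi> V s =
     (MAX a\<in>acts G i. \<Sum>b\<in>acts G (opp i).
        normalized_weight (weighting (weight_param G i)) (acts G (opp i)) (\<pi> s a)
          (outcome G i V s a) b
        * utility (util_param G i) (outcome G i V s a b))"

primrec value_iteration ::
  "('s, 'a) game \<Rightarrow> agent \<Rightarrow> nat \<Rightarrow> ('s \<Rightarrow> real) \<Rightarrow> nat \<Rightarrow> 's \<Rightarrow> real" where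
  "value_iteration G i k V0 0 = V0"
| "value_iteration G i k V0 (Suc m) =
     value_step G i (level_policy G (k - 1) (opp i)) (value_iteration G i k V0 m)"

end

theory Submission
  imports Defs "HOL-Analysis.Analysis"
begin

text \<open>
  The CPT value of a finite random variable is a Choquet integral, so it is monotone in the
  utilities and commutes with adding a constant to them. The weights sum to one, hence the
  normalization does nothing and the value iteration applies the operator of the dynamic
  programming equation. This operator maps every function to a nonnegative one; for nonnegative
  values the outcomes are at least \<open>1\<close>, where \<open>x powr \<alpha>\<close> is nonexpansive, so the operator
  contracts with factor the discount, and Banach's fixed point argument applies.
\<close>

section \<open>The CPT value as a Choquet integral\<close>

lemma listing_properties:
  assumes "finite B"
  shows "distinct (listing B f)" "set (listing B f) = B" "sorted (map f (listing B f))"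
proof -
  obtain xs where "set xs = B" "distinct xs"
    using finite_distinct_list[OF assms] by blast
  then have "distinct (sort_key f xs) \<and> set (sort_key f xs) = B \<and> sorted (map f (sort_key f xs))"
    by simp
  then have "distinct (listing B f) \<and> set (listing B f) = B \<and> sorted (map f (listing B f))"
    unfolding listing_def by (rule someI)
  then show "distinct (listing B f)" "set (listing B f) = B" "sorted (map f (listing B f))"
    by blast+
qed

text \<open>The list is decoupled from the outcomes: \<open>h\<close> stands for the utilities and
  the list may be any enumeration, so that sums over different listings can be compared.\<close>

definition rank_sum ::
  "(real \<Rightarrow> real) \<Rightarrow> ('b \<Rightarrow> real) \<Rightarrow> 'b list \<Rightarrow> ('b \<Rightarrow> real) \<Rightarrow> real" where
  "rank_sum w p xs h = (\<Sum>j<length xs. rank_weight w p xs j * h (xs ! j))"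

lemma CPT_eq_rank_sum: "CPT w u B p f = rank_sum w p (listing B f) (\<lambda>b. u (f b))"
  by (simp add: CPT_def rank_sum_def Let_def)

lemma sum_nth_distinct:
  assumes "distinct xs"
  shows "(\<Sum>l = 0..<length xs. p (xs ! l)) = sum p (set xs)"
  using assms by (simp add: sum.distinct_set_conv_list sum_list_sum_nth)

lemma rank_weight_Cons_0:
  assumes "distinct (x # xs)"
  shows "rank_weight w p (x # xs) 0 = w (sum p (set (x # xs))) - w (sum p (set xs))"
proof -
  have "(\<Sum>l = Suc 0..<length (x # xs). p ((x # xs) ! l)) = sum p (set xs)"
    using assms sum_nth_distinct[of xs p] by (simp only: length_Cons sum.shift_bounds_Suc_ivl) simp
  then show ?thesis
    unfolding rank_weight_def by (simp only: sum_nth_distinct[OF assms])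
qed

lemma rank_weight_Cons_Suc: "rank_weight w p (x # xs) (Suc j) = rank_weight w p xs j"
  unfolding rank_weight_def by (simp only: length_Cons sum.shift_bounds_Suc_ivl nth_Cons_Suc)

lemma rank_sum_Cons:
  assumes "distinct (x # xs)"
  shows "rank_sum w p (x # xs) h =
    (w (sum p (set (x # xs))) - w (sum p (set xs))) * h x + rank_sum w p xs h"
  unfolding rank_sum_def length_Cons sum.lessThan_Suc_shift rank_weight_Cons_Suc
    rank_weight_Cons_0[OF assms] by simp

text \<open>Summation by parts in layer-cake form: raising \<open>t\<close> past the smallest value
  of \<open>h\<close> removes the head of the list from the upper level set. The integrand depends
  only on the set of entries and not on their order. The term with \<open>c\<close> corrects for
  starting the integral at \<open>c\<close> instead of 0, so \<open>h\<close> may be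
  negative.\<close>

lemma rank_sum_has_integral:
  assumes "w 0 = 0" "distinct xs" "sorted (map h xs)" "c \<le> M"
    and "\<And>b. b \<in> set xs \<Longrightarrow> c \<le> h b \<and> h b \<le> M"
  shows "((\<lambda>t. w (sum p {b \<in> set xs. t \<le> h b})) has_integral
           (rank_sum w p xs h - c * w (sum p (set xs)))) {c..M}"
  using assms(2-)
proof (induction xs arbitrary: c)
  case Nil
  then show ?case by (simp add: rank_sum_def assms(1))
next
  case (Cons x xs)
  let ?F = "\<lambda>t. w (sum p {b \<in> set (x # xs). t \<le> h b})"
  have cx: "c \<le> h x" "h x \<le> M" using Cons.prems by auto
  have hx: "h x \<le> h b" if "b \<in> set xs" for b using Cons.prems that by auto
  have "(?F has_integral (h x - c) *\<^sub>R w (sum p (set (x # xs)))) {c..h x}"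
  proof (rule has_integral_eq)
    show "((\<lambda>_. w (sum p (set (x # xs)))) has_integral
        (h x - c) *\<^sub>R w (sum p (set (x # xs)))) {c..h x}"
      using has_integral_const_real[of "w (sum p (set (x # xs)))" c "h x"] cx by simp
  next
    fix t assume "t \<in> {c..h x}"
    then have "{b \<in> set (x # xs). t \<le> h b} = set (x # xs)" using hx by force
    then show "w (sum p (set (x # xs))) = ?F t" by (simp only:)
  qed
  moreover have "(?F has_integral (rank_sum w p xs h - h x * w (sum p (set xs)))) {h x..M}"
  \<comment> \<open>At \<open>t = h x\<close> the head still belongs to the level set, so the
    integrand may differ from that of the induction hypothesis at this single point.\<close>
  proof (rule has_integral_spike_finite[of "{h x}"])
    show "((\<lambda>t. w (sum p {b \<in> set xs. t \<le> h b})) has_integral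
        (rank_sum w p xs h - h x * w (sum p (set xs)))) {h x..M}"
      using Cons.prems hx by (intro Cons.IH) auto
  next
    fix t assume "t \<in> {h x..M} - {h x}"
    then have "{b \<in> set (x # xs). t \<le> h b} = {b \<in> set xs. t \<le> h b}" by auto
    then show "?F t = w (sum p {b \<in> set xs. t \<le> h b})" by (simp only:)
  qed simp
  ultimately have "(?F has_integral ((h x - c) *\<^sub>R w (sum p (set (x # xs)))
      + (rank_sum w p xs h - h x * w (sum p (set xs))))) {c..M}"
    by (rule has_integral_combine[OF cx])
  then show ?case
    unfolding rank_sum_Cons[OF Cons.prems(1)]
    by (rule back_subst[where P = "\<lambda>I. (?F has_integral I) {c..M}"]) (simp add: algebra_simps)
qed

section \<open>Monotonicity and translation of the CPT value\<close>

definition distribution_on :: "'b set \<Rightarrow> ('b \<Rightarrow> real) \<Rightarrow> bool" where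
  "distribution_on B p \<longleftrightarrow> finite B \<and> (\<forall>b\<in>B. 0 \<le> p b) \<and> sum p B = 1"

lemma distribution_on_subset:
  assumes "distribution_on B p" "A \<subseteq> B"
  shows "sum p A \<in> {0..1}"
proof -
  have "sum p A \<le> sum p B"
    using assms unfolding distribution_on_def by (intro sum_mono2) auto
  moreover have "0 \<le> sum p A"
    using assms unfolding distribution_on_def by (intro sum_nonneg) auto
  ultimately show ?thesis using assms unfolding distribution_on_def by auto
qed

text \<open>\<open>w 0 = 0\<close> gives the empty tail no weight, \<open>w 1 = 1\<close> makes the
  weights sum to one, and monotonicity turns inclusion of level sets into an inequality of
  integrands.\<close>

definition normalized_weighting :: "(real \<Rightarrow> real) \<Rightarrow> bool" where
  "normalized_weighting w \<longleftrightarrow> mono_on {0..1} w \<and> w 0 = 0 \<and> w 1 = 1"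

text \<open>The sums cannot be compared term by term, since \<open>h\<close> and \<open>g\<close>
  may order \<open>B\<close> differently. Their integral forms can: the upper level sets of
  \<open>h\<close> lie in those of \<open>g\<close>.\<close>

lemma rank_sum_mono:
  assumes w: "normalized_weighting w" and p: "distribution_on B p"
    and xs: "distinct xs" "set xs = B" "sorted (map h xs)"
    and ys: "distinct ys" "set ys = B" "sorted (map g ys)"
    and le: "\<And>b. b \<in> B \<Longrightarrow> h b \<le> g b"
  shows "rank_sum w p xs h \<le> rank_sum w p ys g"
proof -
  have fin: "finite B" and ne: "B \<noteq> {}" using p unfolding distribution_on_def by auto
  \<comment> \<open>A lower bound of the smaller function and an upper bound of the larger one: a
    single interval serves both integrals, and the correction terms in \<open>c\<close>
    agree.\<close>
  define c where "c = Min (h ` B)"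
  define M where "M = Max (g ` B)"
  have c: "c \<le> h b" if "b \<in> B" for b using that fin by (simp add: c_def)
  have M: "g b \<le> M" if "b \<in> B" for b using that fin by (simp add: M_def)
  have bnd: "c \<le> h b \<and> h b \<le> M" "c \<le> g b \<and> g b \<le> M" if "b \<in> B" for b
    using c[OF that] M[OF that] le[OF that] by linarith+
  have cM: "c \<le> M" using ne bnd by force
  have w0: "w 0 = 0" using w by (simp add: normalized_weighting_def)
  have "rank_sum w p xs h - c * w (sum p (set xs)) \<le> rank_sum w p ys g - c * w (sum p (set ys))"
  proof (rule has_integral_le)
    show "((\<lambda>t. w (sum p {b \<in> set xs. t \<le> h b})) has_integral
           (rank_sum w p xs h - c * w (sum p (set xs)))) {c..M}"
      using xs bnd cM by (intro rank_sum_has_integral w0) auto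
    show "((\<lambda>t. w (sum p {b \<in> set ys. t \<le> g b})) has_integral
           (rank_sum w p ys g - c * w (sum p (set ys)))) {c..M}"
      using ys bnd cM by (intro rank_sum_has_integral w0) auto
  next
    fix t
    have "sum p {b \<in> B. t \<le> h b} \<le> sum p {b \<in> B. t \<le> g b}"
      using fin p le by (intro sum_mono2) (force simp: distribution_on_def)+
    then have "w (sum p {b \<in> B. t \<le> h b}) \<le> w (sum p {b \<in> B. t \<le> g b})"
      using w distribution_on_subset[OF p]
      by (intro mono_onD[of "{0..1}" w]) (auto simp: normalized_weighting_def)
    then show "w (sum p {b \<in> set xs. t \<le> h b}) \<le> w (sum p {b \<in> set ys. t \<le> g b})"
      using xs ys by simp
  qed
  then show ?thesis using xs ys by simp
qed

text \<open>The weighted tail probabilities telescope to \<open>w 1 - w 0\<close>.\<close>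

lemma sum_rank_weight:
  assumes "normalized_weighting w" "distribution_on B p" "distinct xs" "set xs = B"
  shows "(\<Sum>j<length xs. rank_weight w p xs j) = 1"
  using assms unfolding rank_weight_def
  by (subst sum_lessThan_telescope')
    (simp add: sum_nth_distinct normalized_weighting_def distribution_on_def)

lemma rank_sum_add_const:
  assumes "normalized_weighting w" "distribution_on B p" "distinct xs" "set xs = B"
  shows "rank_sum w p xs (\<lambda>b. h b + c) = rank_sum w p xs h + c"
proof -
  have "rank_sum w p xs (\<lambda>b. h b + c) =
      rank_sum w p xs h + (\<Sum>j<length xs. rank_weight w p xs j) * c"
    unfolding rank_sum_def by (simp add: algebra_simps sum.distrib sum_distrib_left)
  then show ?thesis using sum_rank_weight[OF assms] by simp
qed

text \<open>As \<open>u\<close> is monotone, a listing by outcomes is also sorted by utilities, with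
  or without a constant added. The shift sits outside \<open>u\<close> because the CPT value
  commutes with constants added to utilities, not in general to outcomes.\<close>

lemma CPT_le_add_const:
  assumes "normalized_weighting w" "distribution_on B p" "mono u"
    and "\<And>b. b \<in> B \<Longrightarrow> u (f b) \<le> u (g b) + c"
  shows "CPT w u B p f \<le> CPT w u B p g + c"
proof -
  have fin: "finite B" using assms(2) by (simp add: distribution_on_def)
  note f = listing_properties[OF fin, of f] and g = listing_properties[OF fin, of g]
  have sorted: "sorted (map (\<lambda>b. u (k b) + d) xs)" if "sorted (map k xs)"
    for k :: "'a \<Rightarrow> real" and d xs
    using that unfolding sorted_map
    by (rule sorted_wrt_mono_rel[rotated]) (simp add: monoD[OF \<open>mono u\<close>])
  have "rank_sum w p (listing B f) (\<lambda>b. u (f b)) \<le>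
      rank_sum w p (listing B g) (\<lambda>b. u (g b) + c)"
    using assms f g sorted[OF f(3), of 0] sorted[OF g(3), of c]
    by (intro rank_sum_mono[of w B]) auto
  then show ?thesis
    unfolding CPT_eq_rank_sum rank_sum_add_const[OF assms(1,2) g(1,2)] .
qed

text \<open>Comparison with the zero function, for which every list is sorted.\<close>

lemma CPT_nonneg:
  assumes w: "normalized_weighting w" and p: "distribution_on B p" and "mono u" "\<And>x. 0 \<le> u x"
  shows "0 \<le> CPT w u B p f"
proof -
  have fin: "finite B" using p by (simp add: distribution_on_def)
  note f = listing_properties[OF fin, of f]
  have "rank_sum w p (listing B f) (\<lambda>b. 0) \<le> rank_sum w p (listing B f) (\<lambda>b. u (f b))"
  proof (rule rank_sum_mono[OF w p f(1,2) _ f(1,2)])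
    show "sorted (map (\<lambda>b. u (f b)) (listing B f))"
      using f(3) unfolding sorted_map
      by (rule sorted_wrt_mono_rel[rotated]) (simp add: monoD[OF \<open>mono u\<close>])
  qed (use assms in \<open>auto simp: sorted_map\<close>)
  then show ?thesis by (simp add: CPT_eq_rank_sum rank_sum_def)
qed

section \<open>Weights of individual outcomes and their normalization\<close>

lemma cpt_weight_nth:
  assumes "finite B" "j < length (listing B f)"
  shows "cpt_weight w B p f (listing B f ! j) = rank_weight w p (listing B f) j"
proof -
  have "(THE j'. j' < length (listing B f) \<and> listing B f ! j' = listing B f ! j) = j"
    using assms listing_properties(1)[OF assms(1), of f]
    by (intro the_equality) (auto simp: nth_eq_iff_index_eq)
  then show ?thesis by (simp add: cpt_weight_def Let_def)
qed

lemma sum_cpt_weight: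
  assumes "finite B"
  shows "(\<Sum>b\<in>B. cpt_weight w B p f b * h b) = rank_sum w p (listing B f) h"
proof -
  have "bij_betw (\<lambda>j. listing B f ! j) {..<length (listing B f)} B"
    using listing_properties[OF assms, of f] by (intro bij_betw_nth) auto
  then have "(\<Sum>b\<in>B. cpt_weight w B p f b * h b) = (\<Sum>j<length (listing B f).
      cpt_weight w B p f (listing B f ! j) * h (listing B f ! j))"
    by (rule sum.reindex_bij_betw[symmetric])
  then show ?thesis by (simp add: rank_sum_def cpt_weight_nth[OF assms])
qed

lemma sum_normalized_weight:
  assumes w: "normalized_weighting w" and p: "distribution_on B p"
  shows "(\<Sum>b\<in>B. normalized_weight w B p f b * u (f b)) = CPT w u B p f"
proof -
  have fin: "finite B" using p by (simp add: distribution_on_def)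
  have "(\<Sum>b\<in>B. cpt_weight w B p f b) = 1"
    using sum_cpt_weight[OF fin, of w p f "\<lambda>_. 1"]
      sum_rank_weight[OF w p listing_properties(1,2)[OF fin, of f]]
    by (simp add: rank_sum_def)
  then show ?thesis
    by (simp add: normalized_weight_def sum_cpt_weight[OF fin] CPT_eq_rank_sum)
qed

section \<open>Utility and weighting functions\<close>

text \<open>The endpoint values follow from \<open>0 powr \<gamma> = 0\<close>; monotonicity is part
  of the assumption.\<close>

lemma normalized_weighting_weighting:
  assumes "weighting_function (weighting \<gamma>)"
  shows "normalized_weighting (weighting \<gamma>)"
  using assms by (simp add: normalized_weighting_def weighting_function_def weighting_def)

lemma mono_utility: "0 < \<alpha> \<Longrightarrow> mono (utility \<alpha>)"
  by (rule monoI) (auto simp: utility_def intro: powr_mono2)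

lemma utility_nonneg: "0 \<le> utility \<alpha> x"
  by (simp add: utility_def)

text \<open>This is where the reward bound 1 matters: the slope of \<open>x powr \<alpha>\<close> is
  at most 1 for \<open>x\<close> at least 1, but unbounded near 0 when \<alpha> < 1.\<close>

lemma utility_nonexpansive:
  assumes "0 < \<alpha>" "\<alpha> \<le> 1" "1 \<le> x" "1 \<le> y" "x \<le> y + c" "0 \<le> c"
  shows "utility \<alpha> x \<le> utility \<alpha> y + c"
proof -
  have "(y + c) powr \<alpha> \<le> y powr \<alpha> + c"
  proof -
    have "(y + c) powr \<alpha> = y powr \<alpha> * (1 + c / y) powr \<alpha>"
      using assms by (subst powr_mult[symmetric]) (auto simp: distrib_left)
    \<comment> \<open>The base is at least 1 and the exponent at most 1, so the power is at most its
      base.\<close>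
    also have "\<dots> \<le> y powr \<alpha> * (1 + c / y)"
      using assms powr_mono[of \<alpha> 1 "1 + c / y"] by (intro mult_left_mono) auto
    also have "\<dots> = y powr \<alpha> + y powr \<alpha> / y * c"
      by (simp add: algebra_simps)
    also have "\<dots> \<le> y powr \<alpha> + 1 * c"
      using assms powr_mono[of \<alpha> 1 y] by (intro add_left_mono mult_right_mono) auto
    finally show ?thesis by simp
  qed
  moreover have "x powr \<alpha> \<le> (y + c) powr \<alpha>"
    using assms by (intro powr_mono2) auto
  ultimately show ?thesis using assms by (simp add: utility_def)
qed

section \<open>Contractions on nonnegative functions\<close>

text \<open>The estimate is available only between nonnegative functions, but a single application
  of \<open>T\<close> makes any function nonnegative. The bound \<open>c\<close> stands for the sup
  distance.\<close>

locale nonneg_contraction =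
  fixes T :: "('s::finite \<Rightarrow> real) \<Rightarrow> 's \<Rightarrow> real" and \<beta> :: real
  assumes \<beta>: "0 < \<beta>" "\<beta> < 1"
    and nonneg: "0 \<le> T V s"
    and contraction: "\<And>V W c s. (\<And>s. 0 \<le> V s) \<Longrightarrow> (\<And>s. 0 \<le> W s) \<Longrightarrow>
      (\<And>s. \<bar>V s - W s\<bar> \<le> c) \<Longrightarrow> \<bar>T V s - T W s\<bar> \<le> \<beta> * c"
begin

lemma bounded_difference:
  fixes V W :: "'s \<Rightarrow> real"
  obtains c where "\<And>s. \<bar>V s - W s\<bar> \<le> c"
proof
  show "\<bar>V s - W s\<bar> \<le> Max (range (\<lambda>s. \<bar>V s - W s\<bar>))" for s
    by (intro Max_ge) auto
qed

lemma power_contraction: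
  assumes "\<And>s. 0 \<le> V s" "\<And>s. 0 \<le> W s" "\<And>s. \<bar>V s - W s\<bar> \<le> c"
  shows "\<bar>(T ^^ m) V s - (T ^^ m) W s\<bar> \<le> c * \<beta> ^ m"
proof (induction m arbitrary: s)
  case 0
  then show ?case using assms by simp
next
  case (Suc m)
  have nn: "0 \<le> (T ^^ m) U s" if "\<And>s. 0 \<le> U s" for U s
    using that nonneg by (cases m) auto
  have "\<bar>T ((T ^^ m) V) s - T ((T ^^ m) W) s\<bar> \<le> \<beta> * (c * \<beta> ^ m)"
    by (intro contraction nn assms Suc.IH)
  then show ?case by (simp add: mult_ac)
qed

lemma geometric_tendsto: "(\<lambda>m. c * \<beta> ^ m) \<longlonglongrightarrow> 0"
  using \<beta> by (intro tendsto_mult_right_zero LIMSEQ_realpow_zero) auto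

text \<open>\<open>V0\<close> may take negative values, so the contraction is started at
  \<open>T V0\<close>; hence the index shift and the choice of \<open>c\<close> as a bound for
  \<open>T V0 - V\<close>.\<close>

lemma iteration_tendsto:
  assumes "T V = V"
  shows "(\<lambda>m. (T ^^ Suc m) V0 s) \<longlonglongrightarrow> V s"
proof -
  have V: "0 \<le> V s" for s using nonneg[of V s] assms by simp
  obtain c where c: "\<And>s. \<bar>T V0 s - V s\<bar> \<le> c" using bounded_difference by blast
  have fixed: "(T ^^ m) V = V" for m by (induction m) (simp_all add: assms)
  have "\<bar>(T ^^ Suc m) V0 s - V s\<bar> \<le> c * \<beta> ^ m" for m
    using power_contraction[where V = "T V0" and W = V, OF nonneg V c, of m s] by (simp add: fixed funpow_swap1)
  then have "(\<lambda>m. (T ^^ Suc m) V0 s - V s) \<longlonglongrightarrow> 0"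
    by (intro Lim_null_comparison[OF _ geometric_tendsto[of c]]) simp
  then show ?thesis by (rule Lim_null[THEN iffD2])
qed

text \<open>The iterates from zero have geometrically small increments, so they converge at each
  state; the contraction then carries the limit through \<open>T\<close>.\<close>

lemma fixed_point_exists: "\<exists>V. T V = V"
proof -
  define U where "U m = (T ^^ m) (\<lambda>_. 0)" for m
  have U0: "0 \<le> U m s" for m s unfolding U_def using nonneg by (cases m) auto
  obtain c where c: "\<And>s. \<bar>T (\<lambda>_. 0) s - (\<lambda>_. 0) s\<bar> \<le> c"
    using bounded_difference[of "T (\<lambda>_. 0)" "\<lambda>_. 0"] by blast
  have step: "\<bar>U (Suc m) s - U m s\<bar> \<le> c * \<beta> ^ m" for m s
    using power_contraction[where V = "T (\<lambda>_. 0)" and W = "\<lambda>_. 0", OF nonneg _ c, of m s]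
    by (simp add: U_def funpow_swap1)
  have "convergent (\<lambda>m. U m s)" for s
  proof -
    have "summable (\<lambda>m. c * \<beta> ^ m)"
      using \<beta> by (intro summable_mult summable_geometric) auto
    then have "summable (\<lambda>m. U (Suc m) s - U m s)"
      by (rule summable_comparison_test'[where N = 0]) (simp add: step)
    then have "convergent (\<lambda>m. U m s - U 0 s)"
      unfolding summable_iff_convergent sum_lessThan_telescope[of "\<lambda>m. U m s"] .
    then show ?thesis by (simp only: convergent_diff_const_right_iff)
  qed
  then obtain V where V: "\<And>s. (\<lambda>m. U m s) \<longlonglongrightarrow> V s"
    unfolding convergent_def by metis
  have V0: "0 \<le> V s" for s by (rule LIMSEQ_le_const[OF V]) (use U0 in auto)
  \<comment> \<open>The sum over the finitely many states dominates the sup distance and still tends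
    to 0, which upgrades pointwise to uniform convergence.\<close>
  define d where "d m = (\<Sum>s\<in>UNIV. \<bar>U m s - V s\<bar>)" for m
  have d: "\<bar>U m s - V s\<bar> \<le> d m" for m s
    unfolding d_def by (rule member_le_sum) auto
  have "(\<lambda>m. \<Sum>s\<in>UNIV. \<bar>U m s - V s\<bar>) \<longlonglongrightarrow> (\<Sum>s\<in>UNIV. \<bar>V s - V s\<bar>)"
    by (intro tendsto_intros V)
  then have lim: "(\<lambda>m. \<beta> * d m) \<longlonglongrightarrow> 0"
    unfolding d_def by (intro tendsto_mult_right_zero) simp
  have "\<bar>U (Suc m) s - T V s\<bar> \<le> \<beta> * d m" for m s
    using contraction[OF U0 V0 d] by (simp add: U_def)
  then have "(\<lambda>m. U (Suc m) s - T V s) \<longlonglongrightarrow> 0" for s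
    by (intro Lim_null_comparison[OF _ lim]) simp
  then have "(\<lambda>m. U (Suc m) s) \<longlonglongrightarrow> T V s" for s
    by (rule Lim_null[THEN iffD2])
  then have "T V s = V s" for s
    using LIMSEQ_unique LIMSEQ_Suc[OF V] by blast
  then show ?thesis by blast
qed

text \<open>The iterates started at \<open>V\<close> converge to both fixed points.\<close>

lemma fixed_point_unique: "T V = V \<Longrightarrow> T W = W \<Longrightarrow> V = W"
  using iteration_tendsto[of V V] iteration_tendsto[of W V] LIMSEQ_unique by blast

end

section \<open>The dynamic programming operator\<close>

text \<open>Above level 0 the policy is a softmax, which is a distribution whatever the Q-values
  are. Thus no induction over levels is involved, and nothing about \<open>optimal_value\<close> has
  to be known first.\<close>

lemma distribution_on_level_policy:
  assumes G: "valid_game G" and b: "b \<in> acts G (opp j)"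
  shows "distribution_on (acts G j) (level_policy G k j s b)"
proof -
  have fin: "finite (acts G j)" "acts G j \<noteq> {}" using G by (auto simp: valid_game_def)
  show ?thesis
  proof (cases k)
    case 0
    then show ?thesis using G b by (auto simp: distribution_on_def valid_game_def)
  next
    case (Suc k')
    have "(\<Sum>a\<in>acts G j. exp (h a)) > (0::real)" for h :: "'b \<Rightarrow> real"
      using fin by (intro sum_pos) auto
    from this[THEN less_imp_neq] fin show ?thesis
      by (auto simp: Suc distribution_on_def quantal_response_def sum_divide_distrib[symmetric]
          intro!: divide_nonneg_nonneg sum_nonneg)
  qed
qed

definition dp_operator ::
  "('s, 'a) game \<Rightarrow> agent \<Rightarrow> ('s, 'a) policy \<Rightarrow> ('s \<Rightarrow> real) \<Rightarrow> 's \<Rightarrow> real" where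
  "dp_operator G i \<pi> V s = (MAX a\<in>acts G i. Q_value G i \<pi> V s a)"

lemma solves_dp_iff: "solves_dp G i \<pi> V \<longleftrightarrow> dp_operator G i \<pi> V = V"
  by (auto simp: solves_dp_def dp_operator_def fun_eq_iff)

text \<open>A single decision problem against a fixed opponent policy, which separates the
  contraction argument from the recursion over levels.\<close>

locale response_problem =
  fixes G :: "('s::finite, 'a) game" and i :: agent and \<pi> :: "('s, 'a) policy"
  assumes valid: "valid_game G"
    and reward_ge_1: "\<And>s a b. a \<in> acts G i \<Longrightarrow> b \<in> acts G (opp i) \<Longrightarrow> 1 \<le> reward G i s a b"
    and policy: "\<And>s a. a \<in> acts G i \<Longrightarrow> distribution_on (acts G (opp i)) (\<pi> s a)"
begin

lemma acts: "finite (acts G i)" "acts G i \<noteq> {}"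
  and discount: "0 < discount G" "discount G < 1"
  and util_param: "0 < util_param G i" "util_param G i \<le> 1"
  and weighting: "normalized_weighting (weighting (weight_param G i))"
  using valid by (auto simp: valid_game_def intro: normalized_weighting_weighting)

text \<open>It holds for every \<open>V\<close>, whatever its sign, so the iteration follows the
  operator from the first step on.\<close>

lemma value_step_eq: "value_step G i \<pi> V = dp_operator G i \<pi> V"
  unfolding value_step_def dp_operator_def Q_value_def
  using sum_normalized_weight[OF weighting policy] by (intro ext arg_cong[where f = Max]) auto

lemma Q_value_le:
  assumes a: "a \<in> acts G i"
    and nn: "\<And>s. 0 \<le> V s" "\<And>s. 0 \<le> W s" and le: "\<And>s. V s \<le> W s + c" and "0 \<le> c"
  shows "Q_value G i \<pi> V s a \<le> Q_value G i \<pi> W s a + discount G * c"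
  unfolding Q_value_def
proof (rule CPT_le_add_const[OF weighting policy[OF a] mono_utility[OF util_param(1)]])
  fix b assume b: "b \<in> acts G (opp i)"
  \<comment> \<open>Nonnegative continuation values keep the outcomes in the range where the utility
    is nonexpansive.\<close>
  have "1 \<le> outcome G i U s a b" if "\<And>s. 0 \<le> U s" for U
    using reward_ge_1[OF a b, of s] discount that[of "next_state G i s a b"]
      mult_nonneg_nonneg[of "discount G" "U (next_state G i s a b)"]
    unfolding outcome_def by linarith
  moreover have "outcome G i V s a b \<le> outcome G i W s a b + discount G * c"
    using mult_left_mono[OF le[of "next_state G i s a b"], of "discount G"] discount
    by (simp add: outcome_def algebra_simps)
  ultimately show "utility (util_param G i) (outcome G i V s a b)
      \<le> utility (util_param G i) (outcome G i W s a b) + discount G * c"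
    using nn discount \<open>0 \<le> c\<close> by (intro utility_nonexpansive util_param) auto
qed

lemma dp_operator_le:
  assumes "\<And>s. 0 \<le> V s" "\<And>s. 0 \<le> W s" "\<And>s. V s \<le> W s + c" "0 \<le> c"
  shows "dp_operator G i \<pi> V s \<le> dp_operator G i \<pi> W s + discount G * c"
proof -
  have "Q_value G i \<pi> V s a \<le> dp_operator G i \<pi> W s + discount G * c" if "a \<in> acts G i" for a
  proof -
    have "Q_value G i \<pi> W s a \<le> dp_operator G i \<pi> W s"
      using acts that by (simp add: dp_operator_def)
    then show ?thesis using Q_value_le[OF that assms] by (meson add_right_mono order_trans)
  qed
  then show ?thesis using acts by (subst (1) dp_operator_def) simp
qed

text \<open>The utility is nonnegative even at negative outcomes, so the sign of \<open>V\<close>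
  does not matter.\<close>

lemma dp_operator_nonneg: "0 \<le> dp_operator G i \<pi> V s"
proof -
  obtain a where a: "a \<in> acts G i" using acts by blast
  have "0 \<le> Q_value G i \<pi> V s a"
    unfolding Q_value_def using util_param
    by (intro CPT_nonneg weighting policy a mono_utility utility_nonneg) auto
  also have "\<dots> \<le> dp_operator G i \<pi> V s" using acts a by (simp add: dp_operator_def)
  finally show ?thesis .
qed

sublocale nonneg_contraction "dp_operator G i \<pi>" "discount G"
proof
  fix V W :: "'s \<Rightarrow> real" and c s
  assume nn: "\<And>s. 0 \<le> V s" "\<And>s. 0 \<le> W s" and c: "\<And>s. \<bar>V s - W s\<bar> \<le> c"
  have "0 \<le> c" using c[of s] by linarith
  moreover have "V s \<le> W s + c" "W s \<le> V s + c" for s using c[of s] by linarith+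
  ultimately have "dp_operator G i \<pi> V s \<le> dp_operator G i \<pi> W s + discount G * c"
    "dp_operator G i \<pi> W s \<le> dp_operator G i \<pi> V s + discount G * c"
    using nn by (blast intro: dp_operator_le)+
  then show "\<bar>dp_operator G i \<pi> V s - dp_operator G i \<pi> W s\<bar> \<le> discount G * c"
    by linarith
qed (use discount dp_operator_nonneg in auto)

text \<open>The description by \<open>THE\<close> is justified by uniqueness among all functions:
  every fixed point is a value of the operator, hence nonnegative.\<close>

lemma solves_dp_optimal_value: "solves_dp G i \<pi> (optimal_value G i \<pi>)"
  unfolding optimal_value_def
proof (rule theI'[of "solves_dp G i \<pi>"])
  show "\<exists>!V. solves_dp G i \<pi> V"
    unfolding solves_dp_iff using fixed_point_exists fixed_point_unique by blast
qed

end

theorem theorem1: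
  fixes G :: "('s::finite, 'a) game" and Rmin :: real and i :: agent
  assumes "valid_game G"
    and "Rmin \<ge> 1"
    and "\<And>j s a b. a \<in> acts G j \<Longrightarrow> b \<in> acts G (opp j) \<Longrightarrow> reward G j s a b \<ge> Rmin"
  shows "\<forall>k\<ge>1.
    solves_dp G i (level_policy G (k - 1) (opp i)) (V_star G i k) \<and>
    (\<forall>V0 s. (\<lambda>m. value_iteration G i k V0 (Suc m) s) \<longlonglongrightarrow> V_star G i k s)"
proof (intro allI impI)
  fix k :: nat
  let ?\<pi> = "level_policy G (k - 1) (opp i)"
  \<comment> \<open>The opponent's policy is conditioned on an action of \<open>opp (opp i)\<close>,
    which has to be recognized as agent \<open>i\<close>.\<close>
  have opp: "opp (opp i) = i" by (cases i) auto
  interpret response_problem G i ?\<pi>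
  proof
    show "1 \<le> reward G i s a b" if "a \<in> acts G i" "b \<in> acts G (opp i)" for s a b
      using assms(2) assms(3)[OF that, of s] by linarith
    show "distribution_on (acts G (opp i)) (?\<pi> s a)" if "a \<in> acts G i" for s a
      using distribution_on_level_policy[OF assms(1)] that opp by metis
  qed (rule assms(1))
  have solves: "solves_dp G i ?\<pi> (V_star G i k)"
    using solves_dp_optimal_value by (simp add: V_star_def)
  \<comment> \<open>The simplifier turns \<open>k - 1\<close> into \<open>k - Suc 0\<close>;
    unfolding brings the equation for \<open>value_step\<close> to the same form.\<close>
  moreover have "value_iteration G i k V0 m = (dp_operator G i ?\<pi> ^^ m) V0" for V0 m
    by (induction m) (simp_all add: value_step_eq[unfolded One_nat_def])
  ultimately show "solves_dp G i ?\<pi> (V_star G i k) \<and>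
      (\<forall>V0 s. (\<lambda>m. value_iteration G i k V0 (Suc m) s) \<longlonglongrightarrow> V_star G i k s)"
    using iteration_tendsto by (simp only: solves_dp_iff) blast
qed

end
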